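(* Fix $\alpha\in(0,1)$ and let $(p_n)_{n\ge1}$ be a sequence of dimensions. Let $\mu_n$ be a sequence of probability measures on $\mathbb{S}^{p_n-1}$ satisfying $$n\cdot d\big(\mu_n,\mathrm{Unif}(\mathbb{S}^{p_n-1})\big)\to\infty .$$ Then $$\lim_{n\to\infty}\mathbb{P}_{\mu_n}(\phi_n=1)=1,$$ where $\phi_n=\phi_n(X_1,\dots,X_n)$ is the test $\phi_n=\mathbf 1_{\{T_n\ge q_n(\alpha)\}}$, and $\mathbb{P}_{\mu_n}$ means that $X_1,\dots,X_n$ are i.i.d. from $\mu_n$.
   Context: $\mathbb{S}^{p-1}=\{x\in\mathbb{R}^p:\|x\|_2=1\}$, $p_n\geq 2$, with no requirement that $p_n$ diverges. For probability measures $\mu,\nu$ on $\mathbb{S}^{p-1}$, $$d(\mu,\nu)=\sup_{t\in[-1,1]}\big|\mathbb{P}_\mu(X_1^\top Y_1\le t)-\mathbb{P}_\nu(X^\top Y\le t)\big|,$$ where $X_1,Y_1$ are drawn independently from $\mu$ and $X,Y$ independently from $\nu$. With $p=p_n$, $$T_n=\sup_{t\in[-1,1]}\Big|\frac{2}{n(n-1)}\sum_{1\le i<j\le n}\mathbf 1_{\{X_i^\top X_j\le t\}}-m(t)\Big|,$$ where $m(t)=\mathbb{P}(X^\top Y\le t)$ for $X,Y$ i.i.d. uniform on $\mathbb{S}^{p-1}$. The threshold is $q_n(\alpha)=\sqrt2\,c_\alpha/\sqrt{n(n-1)}$, where $c_\alpha$ is determined by $\mathbb{P}(\max_{t\in[0,1]}|B_t|\le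 c_\alpha)=1-\alpha$ for a standard Brownian bridge $(B_t)_{0\le t\le1}$. *)

theory Defs
  imports "HOL-Probability.Probability"
begin

text \<open>
  The dimension varies with the sample size, so a vector of \<open>\<real>\<^sup>p\<close> is an extensional
  function \<open>nat \<Rightarrow> real\<close> on \<open>{..<p}\<close>, i.e. a point of the product space over \<open>{..<p}\<close>.
\<close>

definition dot :: "nat \<Rightarrow> (nat \<Rightarrow> real) \<Rightarrow> (nat \<Rightarrow> real) \<Rightarrow> real" where
  "dot p x y = (\<Sum>i<p. x i * y i)"

definition vnorm :: "nat \<Rightarrow> (nat \<Rightarrow> real) \<Rightarrow> real" where
  "vnorm p x = sqrt (dot p x x)"

definition unit_sphere :: "nat \<Rightarrow> (nat \<Rightarrow> real) set" where
  "unit_sphere p = {x \<in> {..<p} \<rightarrow>\<^sub>E UNIV. vnorm p x = 1}"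

definition sphere_space :: "nat \<Rightarrow> (nat \<Rightarrow> real) measure" where
  "sphere_space p = restrict_space (Pi\<^sub>M {..<p} (\<lambda>_. borel)) (unit_sphere p)"

definition prob_on_sphere :: "nat \<Rightarrow> (nat \<Rightarrow> real) measure \<Rightarrow> bool" where
  "prob_on_sphere p \<mu> \<longleftrightarrow> prob_space \<mu> \<and> sets \<mu> = sets (sphere_space p)"

definition punctured_ball :: "nat \<Rightarrow> (nat \<Rightarrow> real) set" where
  "punctured_ball p = {x \<in> {..<p} \<rightarrow>\<^sub>E UNIV. 0 < vnorm p x \<and> vnorm p x \<le> 1}"

definition radial_projection :: "nat \<Rightarrow> (nat \<Rightarrow> real) \<Rightarrow> (nat \<Rightarrow> real)" where
  "radial_projection p x = (\<lambda>i\<in>{..<p}. x i / vnorm p x)"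

text \<open>
  The normalised surface measure is taken as the cone measure: the law of \<open>x / \<parallel>x\<parallel>\<close> for \<open>x\<close>
  uniform (with respect to Lebesgue measure) on the unit ball. The Lebesgue-null origin is removed
  so that \<open>x / \<parallel>x\<parallel>\<close> always lies on the sphere.
\<close>

definition unif_sphere :: "nat \<Rightarrow> (nat \<Rightarrow> real) measure" where
  "unif_sphere p =
     distr (uniform_measure (restrict_space (Pi\<^sub>M {..<p} (\<lambda>_. lborel)) (punctured_ball p))
              (punctured_ball p))
       (sphere_space p) (radial_projection p)"

definition inner_cdf :: "nat \<Rightarrow> (nat \<Rightarrow> real) measure \<Rightarrow> real \<Rightarrow> real" where
  "inner_cdf p \<mu> t =
     measure (\<mu> \<Otimes>\<^sub>M \<mu>) {(x, y) \<in> space (\<mu> \<Otimes>\<^sub>M \<mu>). dot p x y \<le> t}"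

definition sphere_dist :: "nat \<Rightarrow> (nat \<Rightarrow> real) measure \<Rightarrow> (nat \<Rightarrow> real) measure \<Rightarrow> real" where
  "sphere_dist p \<mu> \<nu> = (SUP t\<in>{-1..1}. \<bar>inner_cdf p \<mu> t - inner_cdf p \<nu> t\<bar>)"

definition test_statistic :: "nat \<Rightarrow> nat \<Rightarrow> (nat \<Rightarrow> nat \<Rightarrow> real) \<Rightarrow> real" where
  "test_statistic p n X =
     (SUP t\<in>{-1..1}.
        \<bar>2 / (real n * (real n - 1)) *
           (\<Sum>(i, j)\<in>{(i, j). 1 \<le> i \<and> i < j \<and> j \<le> n}. if dot p (X i) (X j) \<le> t then 1 else 0)
         - inner_cdf p (unif_sphere p) t\<bar>)"

definition threshold :: "nat \<Rightarrow> real \<Rightarrow> real" where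
  "threshold n c = sqrt 2 * c / sqrt (real n * (real n - 1))"

definition unif_test :: "nat \<Rightarrow> nat \<Rightarrow> real \<Rightarrow> (nat \<Rightarrow> nat \<Rightarrow> real) \<Rightarrow> real" where
  "unif_test p n c X = (if test_statistic p n X \<ge> threshold n c then 1 else 0)"

text \<open>
  The library density \<open>normal_density m \<sigma>\<close> needs \<open>\<sigma> > 0\<close>; a Gaussian process may have
  degenerate finite-dimensional laws (the bridge vanishes at 0 and 1), so constants are included.
\<close>

definition normal_rv :: "'w measure \<Rightarrow> ('w \<Rightarrow> real) \<Rightarrow> bool" where
  "normal_rv M X \<longleftrightarrow> X \<in> borel_measurable M \<and>
     ((\<exists>m. AE \<omega> in M. X \<omega> = m) \<or>
      (\<exists>m \<sigma>. \<sigma> > 0 \<and> distributed M lborel X (\<lambda>x. ennreal (normal_density m \<sigma> x))))"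

definition gaussian_process :: "'w measure \<Rightarrow> 't set \<Rightarrow> ('t \<Rightarrow> 'w \<Rightarrow> real) \<Rightarrow> bool" where
  "gaussian_process M T B \<longleftrightarrow>
     (\<forall>I a. finite I \<longrightarrow> I \<subseteq> T \<longrightarrow> normal_rv M (\<lambda>\<omega>. \<Sum>t\<in>I. a t * B t \<omega>))"

definition brownian_bridge :: "'w measure \<Rightarrow> (real \<Rightarrow> 'w \<Rightarrow> real) \<Rightarrow> bool" where
  "brownian_bridge M B \<longleftrightarrow>
     prob_space M \<and>
     gaussian_process M {0..1} B \<and>
     (\<forall>t\<in>{0..1}. (\<integral>\<omega>. B t \<omega> \<partial>M) = 0) \<and>
     (\<forall>s\<in>{0..1}. \<forall>t\<in>{0..1}. (\<integral>\<omega>. B s \<omega> * B t \<omega> \<partial>M) = min s t - s * t) \<and>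
     (\<forall>\<omega>\<in>space M. continuous_on {0..1} (\<lambda>t. B t \<omega>))"

lemma vnorm_measurable: "vnorm p \<in> borel_measurable (Pi\<^sub>M {..<p} (\<lambda>_. borel))"
  unfolding vnorm_def dot_def by measurable

lemma sets_lborel_borel: "sets (Pi\<^sub>M {..<p} (\<lambda>_. lborel :: real measure)) = sets (Pi\<^sub>M {..<p} (\<lambda>_. borel))"
  by (intro sets_PiM_cong) auto

lemma punctured_ball_sets: "punctured_ball p \<in> sets (Pi\<^sub>M {..<p} (\<lambda>_. lborel))"
proof -
  have "{x \<in> space (Pi\<^sub>M {..<p} (\<lambda>_. borel)). 0 < vnorm p x \<and> vnorm p x \<le> 1}
          \<in> sets (Pi\<^sub>M {..<p} (\<lambda>_. borel))"
    using vnorm_measurable[of p] by measurable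
  then show ?thesis
    unfolding sets_lborel_borel by (simp add: punctured_ball_def space_PiM)
qed

lemma unit_sphere_sets: "unit_sphere p \<in> sets (Pi\<^sub>M {..<p} (\<lambda>_. borel))"
proof -
  have "{x \<in> space (Pi\<^sub>M {..<p} (\<lambda>_. borel)). vnorm p x = 1} \<in> sets (Pi\<^sub>M {..<p} (\<lambda>_. borel))"
    using vnorm_measurable[of p] by measurable
  then show ?thesis by (simp add: unit_sphere_def space_PiM)
qed

lemma dot_nonneg: "dot p x x \<ge> 0"
  unfolding dot_def by (intro sum_nonneg) auto

lemma vnorm_radial_projection:
  assumes "vnorm p x > 0" shows "vnorm p (radial_projection p x) = 1"
proof -
  have "dot p (radial_projection p x) (radial_projection p x) = dot p x x / (vnorm p x)\<^sup>2"
    unfolding radial_projection_def dot_def by (simp add: sum_divide_distrib power2_eq_square)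
  also have "\<dots> = 1" using assms dot_nonneg[of p x] by (simp add: vnorm_def)
  finally show ?thesis by (simp add: vnorm_def)
qed

lemma radial_projection_measurable:
  "radial_projection p
     \<in> measurable (restrict_space (Pi\<^sub>M {..<p} (\<lambda>_. lborel)) (punctured_ball p)) (sphere_space p)"
  unfolding sphere_space_def
proof (rule measurable_restrict_space2)
  have "radial_projection p x \<in> unit_sphere p" if "x \<in> punctured_ball p" for x
  proof -
    have "radial_projection p x \<in> {..<p} \<rightarrow>\<^sub>E UNIV"
      by (auto simp: radial_projection_def)
    moreover have "vnorm p (radial_projection p x) = 1"
      using that by (intro vnorm_radial_projection) (simp add: punctured_ball_def)
    ultimately show ?thesis by (simp add: unit_sphere_def)
  qed
  then show "radial_projection p
      \<in> space (restrict_space (Pi\<^sub>M {..<p} (\<lambda>_. lborel)) (punctured_ball p)) \<rightarrow> unit_sphere p"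
    unfolding space_restrict_space by blast
  have "(\<lambda>x. \<lambda>i\<in>{..<p}. x i / vnorm p x)
      \<in> measurable (Pi\<^sub>M {..<p} (\<lambda>_. borel)) (Pi\<^sub>M {..<p} (\<lambda>_. borel))"
    by (rule measurable_restrict)
       (rule borel_measurable_divide[OF measurable_component_singleton vnorm_measurable])
  then have "radial_projection p \<in> measurable (Pi\<^sub>M {..<p} (\<lambda>_. lborel)) (Pi\<^sub>M {..<p} (\<lambda>_. borel))"
    unfolding radial_projection_def measurable_cong_sets[OF sets_lborel_borel refl] .
  then show "radial_projection p
      \<in> measurable (restrict_space (Pi\<^sub>M {..<p} (\<lambda>_. lborel)) (punctured_ball p))
          (Pi\<^sub>M {..<p} (\<lambda>_. borel))"
    by (rule measurable_restrict_space1)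
qed

lemma emeasure_punctured_ball:
  assumes "p \<ge> 1"
  shows "emeasure (Pi\<^sub>M {..<p} (\<lambda>_. lborel)) (punctured_ball p) \<noteq> 0"
    and "emeasure (Pi\<^sub>M {..<p} (\<lambda>_. lborel)) (punctured_ball p) \<noteq> \<infinity>"
proof -
  interpret lborel_product: product_sigma_finite "\<lambda>_::nat. lborel :: real measure"
    by standard
  let ?L = "Pi\<^sub>M {..<p} (\<lambda>_. lborel :: real measure)"
  let ?C = "{..<p} \<rightarrow>\<^sub>E {1 / (2 * real p) .. 1 / real p}"
  let ?D = "{..<p} \<rightarrow>\<^sub>E {-1..1::real}"
  have em: "emeasure ?L ({..<p} \<rightarrow>\<^sub>E {a..b}) = ennreal (b - a) ^ p" if "a \<le> b" for a b :: real
    using that by (subst lborel_product.emeasure_PiM) auto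
  have "?C \<subseteq> punctured_ball p"
  proof
    fix x assume x: "x \<in> ?C"
    then have xi: "1 / (2 * real p) \<le> x i" "x i \<le> 1 / real p" if "i < p" for i
      using that by (auto simp: PiE_iff)
    have pos: "0 < x i" if "i < p" for i
      using assms by (intro less_le_trans[OF _ xi(1)[OF that]]) auto
    have "0 < dot p x x"
      unfolding dot_def using pos assms by (intro sum_pos) (auto simp: lessThan_empty_iff)
    moreover have "dot p x x \<le> (\<Sum>i<p. 1 / real p * 1)"
      unfolding dot_def
    proof (intro sum_mono mult_mono)
      fix i assume "i \<in> {..<p}"
      then have i: "i < p" by simp
      show "x i \<le> 1 / real p" "0 \<le> x i" using xi[OF i] pos[OF i] by auto
      have "1 / real p \<le> 1" using assms by simp
      then show "x i \<le> 1" using xi[OF i] by linarith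
    qed auto
    moreover have "(\<Sum>i<p. 1 / real p * 1) = 1" using assms by simp
    ultimately show "x \<in> punctured_ball p"
      using x by (auto simp: punctured_ball_def vnorm_def PiE_iff)
  qed
  then have "emeasure ?L ?C \<le> emeasure ?L (punctured_ball p)"
    by (intro emeasure_mono punctured_ball_sets)
  moreover have "emeasure ?L ?C \<noteq> 0"
    using assms by (subst em) (auto simp: field_simps)
  ultimately show "emeasure ?L (punctured_ball p) \<noteq> 0" by auto
  have "punctured_ball p \<subseteq> ?D"
  proof
    fix x assume x: "x \<in> punctured_ball p"
    have "x i * x i \<le> 1" if "i < p" for i
    proof -
      have "x i * x i \<le> dot p x x"
        unfolding dot_def using that by (intro member_le_sum) auto
      also have "\<dots> \<le> 1" using x by (auto simp: punctured_ball_def vnorm_def)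
      finally show ?thesis .
    qed
    then have b: "-1 \<le> x i \<and> x i \<le> 1" if "i < p" for i
      using that abs_square_le_1[of "x i"] unfolding power2_eq_square by (smt (verit))
    then show "x \<in> ?D" using x by (simp add: punctured_ball_def PiE_iff)
  qed
  then have "emeasure ?L (punctured_ball p) \<le> emeasure ?L ?D"
    by (intro emeasure_mono sets_PiM_I_finite) auto
  also have "\<dots> < \<infinity>" by (subst em) (auto simp: ennreal_power power_less_top_ennreal)
  finally show "emeasure ?L (punctured_ball p) \<noteq> \<infinity>" by simp
qed

lemma prob_on_sphere_unif_sphere:
  assumes "p \<ge> 1" shows "prob_on_sphere p (unif_sphere p)"
proof -
  let ?L = "Pi\<^sub>M {..<p} (\<lambda>_. lborel :: real measure)"
  let ?R = "restrict_space ?L (punctured_ball p)"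
  have sub: "punctured_ball p \<inter> space ?L = punctured_ball p"
    using sets.sets_into_space[OF punctured_ball_sets] by blast
  have em: "emeasure ?R (punctured_ball p) = emeasure ?L (punctured_ball p)"
    by (rule emeasure_restrict_space) (simp_all add: sub punctured_ball_sets)
  have "prob_space (uniform_measure ?R (punctured_ball p))"
    by (rule prob_space_uniform_measure) (use em emeasure_punctured_ball[OF assms] in auto)
  moreover have "radial_projection p
      \<in> measurable (uniform_measure ?R (punctured_ball p)) (sphere_space p)"
    using radial_projection_measurable by (simp add: measurable_cong_sets[OF sets_uniform_measure refl])
  ultimately have "prob_space (unif_sphere p)"
    unfolding unif_sphere_def by (rule prob_space.prob_space_distr)
  then show ?thesis by (simp add: prob_on_sphere_def unif_sphere_def)
qed

end

theory Submission
  imports Defs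
begin

text \<open>
  Fix for each \<open>n\<close> a level \<open>t\<close> at which the bias \<open>\<Delta>\<close> of the U-statistic is at least half the
  distance to uniformity, so that \<open>n \<Delta> \<rightarrow> \<infinity>\<close>. In the Hoeffding decomposition, the degenerate part is
  \<open>O(1/n)\<close> in \<open>L\<^sup>2\<close>, like the threshold. The linear part has variance \<open>4 \<zeta> / n\<close>, where \<open>\<zeta>\<close> need not be
  small compared with \<open>n \<Delta>\<^sup>2\<close>, so Chebyshev's inequality alone does not suffice. If \<open>n \<zeta>\<close> is bounded,
  Chebyshev's inequality shows that the linear part cannot compensate the bias; if \<open>n \<zeta>\<close> is large,
  an Esseen-type concentration inequality shows that the linear part is too spread out to bring the
  statistic within \<open>O(1/n)\<close> of any given number. Either way the test rejects.
\<close>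

section \<open>Second moments and integrals over i.i.d. samples\<close>

lemma (in prob_space) second_moment_orthogonal_sum:
  fixes Z :: "'i \<Rightarrow> 'a \<Rightarrow> real"
  assumes "finite E"
    and "\<And>e e'. e \<in> E \<Longrightarrow> e' \<in> E \<Longrightarrow> integrable M (\<lambda>x. Z e x * Z e' x)"
    and "\<And>e e'. e \<in> E \<Longrightarrow> e' \<in> E \<Longrightarrow> e \<noteq> e' \<Longrightarrow> expectation (\<lambda>x. Z e x * Z e' x) = 0"
  shows "expectation (\<lambda>x. (\<Sum>e\<in>E. Z e x)\<^sup>2) = (\<Sum>e\<in>E. expectation (\<lambda>x. (Z e x)\<^sup>2))"
proof -
  have "expectation (\<lambda>x. (\<Sum>e\<in>E. Z e x)\<^sup>2)
      = (\<Sum>e\<in>E. \<Sum>e'\<in>E. expectation (\<lambda>x. Z e x * Z e' x))"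
    using assms(2) by (simp add: power2_eq_square sum_product Bochner_Integration.integral_sum)
  also have "\<dots> = (\<Sum>e\<in>E. \<Sum>e'\<in>E. if e = e' then expectation (\<lambda>x. (Z e x)\<^sup>2) else 0)"
    using assms(3) by (intro sum.cong refl) (auto simp: power2_eq_square)
  finally show ?thesis using assms(1) by simp
qed

lemma (in prob_space) second_moment_tail_bound:
  fixes Z :: "'a \<Rightarrow> real"
  assumes "integrable M (\<lambda>x. (Z x)\<^sup>2)" and [measurable]: "Z \<in> borel_measurable M" and "0 < L"
  shows "prob {x \<in> space M. \<bar>Z x\<bar> \<ge> L} \<le> expectation (\<lambda>x. (Z x)\<^sup>2) / L\<^sup>2"
proof -
  have "{x \<in> space M. \<bar>Z x\<bar> \<ge> L} = {x \<in> space M. (Z x)\<^sup>2 \<ge> L\<^sup>2}"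
    using abs_le_square_iff[of L] \<open>0 < L\<close> by auto
  then show ?thesis
    using integral_Markov_inequality_measure[OF assms(1), of "{}" "L\<^sup>2"] assms(3) by simp
qed

lemma (in prob_space) prob_space_iid: "prob_space (Pi\<^sub>M I (\<lambda>_. M))"
  by (intro prob_space_PiM prob_space_axioms)

text \<open>Fubini with coordinate \<open>i\<close> innermost. A product has mean zero as soon as
  \<open>i\<close> enters only one factor and that factor is centred in \<open>i\<close>; the
  orthogonality relations for both parts of the Hoeffding decomposition arise this way.\<close>

lemma (in prob_space) integral_PiM_eq_0I:
  fixes f :: "('i \<Rightarrow> 'a) \<Rightarrow> real"
  assumes "finite I" and "i \<in> I" and "integrable (Pi\<^sub>M I (\<lambda>_. M)) f"
    and "\<And>x. x \<in> space (Pi\<^sub>M (I - {i}) (\<lambda>_. M)) \<Longrightarrow> (\<integral>y. f (x(i := y)) \<partial>M) = 0"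
  shows "(\<integral>x. f x \<partial>Pi\<^sub>M I (\<lambda>_. M)) = 0"
proof -
  interpret product_sigma_finite "\<lambda>_::'i. M"
    by standard
  have "insert i (I - {i}) = I" using assms(2) by auto
  then have "(\<integral>x. f x \<partial>Pi\<^sub>M I (\<lambda>_. M))
      = (\<integral>x. (\<integral>y. f (x(i := y)) \<partial>M) \<partial>Pi\<^sub>M (I - {i}) (\<lambda>_. M))"
    using product_integral_insert[of "I - {i}" i f] assms(1,3) by simp
  also have "\<dots> = (\<integral>x. 0 \<partial>Pi\<^sub>M (I - {i}) (\<lambda>_::'i. M))"
    using assms(4) by (intro Bochner_Integration.integral_cong) auto
  finally show ?thesis by simp
qed

lemma (in prob_space) integral_PiM_component:
  fixes f :: "'a \<Rightarrow> real"
  assumes "finite I" and "i \<in> I" and f [measurable]: "f \<in> borel_measurable M"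
  shows "(\<integral>x. f (x i) \<partial>Pi\<^sub>M I (\<lambda>_. M)) = expectation f"
proof -
  have "distr (Pi\<^sub>M I (\<lambda>_. M)) M (\<lambda>x. x i) = M"
    using assms(2) prob_space_axioms by (intro distr_PiM_component) auto
  then show ?thesis
    using integral_distr[of "\<lambda>x. x i" "Pi\<^sub>M I (\<lambda>_. M)" M f] assms(2) by simp
qed

section \<open>Sums over pairs of indices\<close>

definition index_pairs :: "nat \<Rightarrow> (nat \<times> nat) set" where
  "index_pairs n = {(i, j). 1 \<le> i \<and> i < j \<and> j \<le> n}"

lemma finite_index_pairs [simp]: "finite (index_pairs n)"
  by (rule finite_subset[of _ "{1..n} \<times> {1..n}"]) (auto simp: index_pairs_def)

text \<open>Each index lies in exactly \<open>n - 1\<close> pairs. This turns the linear terms of a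
  sum over pairs into a plain sum over the sample. For \<open>n = 0\<close> the factor is -1, but it
  multiplies an empty sum.\<close>

lemma sum_index_pairs_add:
  fixes f :: "nat \<Rightarrow> real"
  shows "(\<Sum>(i, j)\<in>index_pairs n. f i + f j) = (real n - 1) * (\<Sum>i=1..n. f i)"
proof (induction n)
  case 0
  have "index_pairs 0 = {}" by (auto simp: index_pairs_def)
  then show ?case by simp
next
  case (Suc n)
  have eq: "index_pairs (Suc n) = index_pairs n \<union> (\<lambda>i. (i, Suc n)) ` {1..n}"
    by (auto simp: index_pairs_def)
  have "(\<Sum>(i, j)\<in>index_pairs (Suc n). f i + f j)
      = (\<Sum>(i, j)\<in>index_pairs n. f i + f j) + (\<Sum>i=1..n. f i + f (Suc n))"
    unfolding eq
    by (subst sum.union_disjoint) (use finite_index_pairs in \<open>auto simp: index_pairs_def sum.reindex inj_on_def\<close>)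
  also have "\<dots> = (real n - 1) * (\<Sum>i=1..n. f i) + (\<Sum>i=1..n. f i) + real n * f (Suc n)"
    unfolding Suc.IH by (simp add: sum.distrib)
  finally show ?case by (simp add: algebra_simps)
qed

lemma card_index_pairs: "real (card (index_pairs n)) = real n * (real n - 1) / 2"
  \<comment> \<open>With the constant 1/2, every pair contributes 1.\<close>
  using sum_index_pairs_add[of "\<lambda>_. 1 / 2" n] by (simp add: case_prod_unfold)

lemma measurable_index_pair:
  assumes [measurable]: "case_prod k \<in> borel_measurable (M \<Otimes>\<^sub>M M)" and e: "e \<in> index_pairs n"
  shows "(\<lambda>X. k (X (fst e)) (X (snd e))) \<in> borel_measurable (Pi\<^sub>M {1..n} (\<lambda>_. M))"
proof -
  have [measurable]: "fst e \<in> {1..n}" "snd e \<in> {1..n}"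
    using e by (auto simp: index_pairs_def)
  show ?thesis by measurable
qed

section \<open>Gaussian smoothing and anti-concentration of i.i.d. sums\<close>

lemma std_normal_tail_bound:
  assumes "0 < K"
  shows "measure std_normal_distribution {z. \<bar>z\<bar> \<ge> K} \<le> 1 / K\<^sup>2"
proof -
  interpret N: real_distribution std_normal_distribution by (rule real_dist_normal_dist)
  have "(\<integral>z. z\<^sup>2 \<partial>std_normal_distribution) = 1"
    using std_normal_distribution_even_moments(1)[of 1] by simp
  then show ?thesis
    using N.second_moment_tail_bound[of "\<lambda>z. z" K] integrable_std_normal_distribution_moment[of 2]
      assms by simp
qed

text \<open>Dominated convergence: the integrand tends to 0 except at \<open>z = 0\<close>, a null
  set of the normal law. Here \<open>m\<close> stands for a lower bound on the variance of the
  linear sum; it is a natural number so that the limit is along a sequence.\<close>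

lemma std_normal_laplace_tendsto_0:
  assumes "0 < b"
  shows "(\<lambda>m::nat. \<integral>z. exp (- (b * real m * z\<^sup>2)) \<partial>std_normal_distribution) \<longlonglongrightarrow> 0"
proof -
  interpret N: real_distribution std_normal_distribution by (rule real_dist_normal_dist)
  have "AE z in std_normal_distribution. z \<noteq> 0"
    using AE_lborel_singleton[of "0::real"] by (subst AE_density) auto
  moreover have "(\<lambda>m::nat. exp (- (b * real m * z\<^sup>2))) \<longlonglongrightarrow> 0" if "z \<noteq> 0" for z
  proof -
    define k where "k = b * z\<^sup>2"
    have "k > 0" using assms that by (simp add: k_def)
    then have "(\<lambda>m::nat. exp (- (k * real m))) \<longlonglongrightarrow> 0" by real_asymp
    then show ?thesis by (simp add: k_def mult_ac)
  qed
  ultimately have "AE z in std_normal_distribution. (\<lambda>m::nat. exp (- (b * real m * z\<^sup>2))) \<longlonglongrightarrow> 0"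
    by (auto elim: eventually_mono)
  then have "(\<lambda>m::nat. \<integral>z. exp (- (b * real m * z\<^sup>2)) \<partial>std_normal_distribution)
      \<longlonglongrightarrow> (\<integral>z. 0 \<partial>std_normal_distribution)"
    using assms
    by (intro integral_dominated_convergence[where w = "\<lambda>_. 1"]) auto
  then show ?thesis by simp
qed

text \<open>
  With \<open>v = n Var f\<close>, the second term vanishes as \<open>v\<close> grows, for fixed \<open>\<Lambda>\<close>. The indicator of
  \<open>\<bar>s\<bar> \<le> \<Lambda>\<close> is dominated by a multiple of the Gaussian \<open>exp (- s\<^sup>2 / (2 \<Lambda>\<^sup>2))\<close>, an average of the
  characters of frequency \<open>z / \<Lambda>\<close>; the expansion of the characteristic function of \<open>f\<close> is only
  available for frequencies up to 1, which leaves the Gaussian tail as an error.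
\<close>

lemma (in prob_space) iid_sum_anti_concentration:
  fixes f :: "'a \<Rightarrow> real"
  assumes f [measurable]: "f \<in> borel_measurable M" and bound: "\<And>x. \<bar>f x\<bar> \<le> 1"
    and mean: "expectation f = 0" and "0 < \<Lambda>" and "0 \<le> v"
    and v: "v \<le> real n * expectation (\<lambda>x. (f x)\<^sup>2)"
  shows "measure (Pi\<^sub>M {1..n} (\<lambda>_. M))
      {X \<in> space (Pi\<^sub>M {1..n} (\<lambda>_. M)). \<bar>(\<Sum>i=1..n. f (X i)) - a\<bar> \<le> \<Lambda>}
    \<le> 2 * (1 / \<Lambda>\<^sup>2 + (\<integral>z. exp (- (v * z\<^sup>2 / (3 * \<Lambda>\<^sup>2))) \<partial>std_normal_distribution))"
proof -
  let ?P = "Pi\<^sub>M {1..n} (\<lambda>_. M)" and ?N = std_normal_distribution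
  let ?S = "\<lambda>X. \<Sum>i=1..n. f (X i)"
  define \<sigma>2 where "\<sigma>2 = expectation (\<lambda>x. (f x)\<^sup>2)"
  define \<phi> where "\<phi> t = (CLINT x|M. iexp (t * f x))" for t
  define G where "G X = exp (- ((?S X - a) / \<Lambda>)\<^sup>2 / 2)" for X
  interpret N: real_distribution ?N by (rule real_dist_normal_dist)
  interpret P: prob_space ?P by (rule prob_space_iid)
  interpret PN: pair_prob_space ?P ?N ..
  interpret PM: product_sigma_finite "\<lambda>_::nat. M" by standard
  have G_meas [measurable]: "G \<in> borel_measurable ?P" unfolding G_def by measurable
  have int_f2: "integrable M (\<lambda>x. (f x)\<^sup>2)"
    by (intro integrable_const_bound[of _ 1]) (auto simp: bound abs_square_le_1)
  have "0 \<le> \<sigma>2" unfolding \<sigma>2_def by simp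
  have "\<sigma>2 \<le> 1"
    unfolding \<sigma>2_def using integral_mono[OF int_f2, of "\<lambda>_. 1"]
    by (simp add: bound abs_square_le_1 prob_space)
  have \<phi>_le_1: "cmod (\<phi> t) \<le> 1" for t
    unfolding \<phi>_def using integral_norm_bound[of M "\<lambda>x. iexp (t * f x)"] by (simp add: prob_space)
  \<comment> \<open>Second-order expansion. As \<open>\<bar>t * f x\<bar> \<le> 1\<close>, the cubic
    remainder is at most a sixth of \<open>t\<^sup>2 * \<sigma>2\<close>, and 1/2 - 1/6 = 1/3 is the
    constant in the exponent.\<close>
  have \<phi>_le: "cmod (\<phi> t) \<le> exp (- (t\<^sup>2 * \<sigma>2 / 3))" if t: "\<bar>t\<bar> \<le> 1" for t
  proof -
    have char: "\<phi> t = char (distr M borel f) t"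
      unfolding \<phi>_def char_def by (subst integral_distr) auto
    have approx: "cmod (char (distr M borel f) t - (1 - t\<^sup>2 * \<sigma>2 / 2))
        \<le> (t\<^sup>2 / 6) * expectation (\<lambda>x. min (6 * (f x)\<^sup>2) (\<bar>t\<bar> * \<bar>f x\<bar> ^ 3))"
      by (rule char_approx3')
        (auto simp: mean \<sigma>2_def int_f2 bound intro!: integrable_const_bound[of _ 1])
    have "expectation (\<lambda>x. min (6 * (f x)\<^sup>2) (\<bar>t\<bar> * \<bar>f x\<bar> ^ 3)) \<le> \<sigma>2"
      unfolding \<sigma>2_def
    proof (intro integral_mono int_f2)
      fix x
      have "\<bar>t\<bar> * \<bar>f x\<bar> ^ 3 = (\<bar>t\<bar> * \<bar>f x\<bar>) * (f x)\<^sup>2" by (simp add: power2_eq_square power3_eq_cube)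
      also have "\<dots> \<le> 1 * (f x)\<^sup>2" using t bound[of x] by (intro mult_right_mono mult_le_one) auto
      finally show "min (6 * (f x)\<^sup>2) (\<bar>t\<bar> * \<bar>f x\<bar> ^ 3) \<le> (f x)\<^sup>2" by simp
    next
      show "integrable M (\<lambda>x. min (6 * (f x)\<^sup>2) (\<bar>t\<bar> * \<bar>f x\<bar> ^ 3))"
        by (rule Bochner_Integration.integrable_bound[of _ "\<lambda>x. 6 * (f x)\<^sup>2"]) (auto simp: int_f2)
    qed
    then have third: "t\<^sup>2 / 6 * expectation (\<lambda>x. min (6 * (f x)\<^sup>2) (\<bar>t\<bar> * \<bar>f x\<bar> ^ 3)) \<le> t\<^sup>2 / 6 * \<sigma>2"
      by (rule mult_left_mono) simp
    have "cmod (\<phi> t - (1 - t\<^sup>2 * \<sigma>2 / 2)) \<le> t\<^sup>2 / 6 * \<sigma>2"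
      using order_trans[OF approx third] unfolding char .
    then have "cmod (\<phi> t) \<le> cmod (1 - t\<^sup>2 * \<sigma>2 / 2) + t\<^sup>2 / 6 * \<sigma>2"
      using norm_triangle_sub[of "\<phi> t" "complex_of_real (1 - t\<^sup>2 * \<sigma>2 / 2)"] by linarith
    \<comment> \<open>This keeps the main term nonnegative, so its modulus is the term
      itself.\<close>
    moreover have "t\<^sup>2 * \<sigma>2 \<le> 1"
      using t \<open>0 \<le> \<sigma>2\<close> \<open>\<sigma>2 \<le> 1\<close> by (intro mult_le_one) (auto simp: abs_square_le_1)
    then have "cmod (complex_of_real (1 - t\<^sup>2 * \<sigma>2 / 2)) = 1 - t\<^sup>2 * \<sigma>2 / 2"
      unfolding norm_of_real by simp
    ultimately have "cmod (\<phi> t) \<le> 1 + - (t\<^sup>2 * \<sigma>2 / 3)" by (simp add: mult.commute)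
    also have "\<dots> \<le> exp (- (t\<^sup>2 * \<sigma>2 / 3))" by (rule exp_ge_add_one_self)
    finally show ?thesis .
  qed
  have char_S: "(CLINT X|?P. iexp (t * ?S X)) = \<phi> t ^ n" for t
  proof -
    have "(CLINT X|?P. iexp (t * ?S X)) = (CLINT X|?P. \<Prod>i=1..n. iexp (t * f (X i)))"
      by (simp add: exp_sum sum_distrib_left)
    also have "\<dots> = (\<Prod>i::nat=1..n. \<phi> t)"
      unfolding \<phi>_def
      by (rule PM.product_integral_prod) (auto intro!: integrable_const_bound[of _ 1])
    finally show ?thesis by simp
  qed
  have int_exp: "integrable ?N (\<lambda>z. exp (- (v * z\<^sup>2 / (3 * \<Lambda>\<^sup>2))))"
    using \<open>0 \<le> v\<close> by (intro N.integrable_const_bound[of _ 1]) auto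
  have int_ind: "integrable ?N (indicator {z. \<bar>z\<bar> \<ge> \<Lambda>} :: real \<Rightarrow> real)"
    by (intro N.integrable_const_bound[of _ 1]) auto
  have phi_meas [measurable]: "\<phi> \<in> borel_measurable borel"
    unfolding \<phi>_def by measurable
  \<comment> \<open>The characteristic function of the standard normal law at \<open>u\<close> is
    \<open>exp (- u\<^sup>2 / 2)\<close>; with \<open>u = (?S X - a) / \<Lambda>\<close> this is
    \<open>G X\<close>. So \<open>G\<close> is an average of characters of the sum.\<close>
  have "complex_of_real (P.expectation G)
      = (CLINT X|?P. CLINT z|?N. iexp ((?S X - a) / \<Lambda> * z))"
    unfolding integral_complex_of_real[symmetric] G_def
      fun_cong[OF char_std_normal_distribution, unfolded char_def, symmetric] ..
  also have "\<dots> = (CLINT z|?N. CLINT X|?P. iexp ((?S X - a) / \<Lambda> * z))"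
  proof (rule PN.Fubini_integral[symmetric], rule PN.P.integrable_const_bound[of _ 1])
    show "AE w in ?P \<Otimes>\<^sub>M ?N. norm (case w of (X, z) \<Rightarrow> iexp ((?S X - a) / \<Lambda> * z)) \<le> 1"
      unfolding case_prod_unfold norm_exp_i_times by simp
    show "(\<lambda>(X, z). iexp ((?S X - a) / \<Lambda> * z)) \<in> borel_measurable (?P \<Otimes>\<^sub>M ?N)"
      by measurable
  qed
  \<comment> \<open>The centre \<open>a\<close> survives only in a factor of modulus 1, which makes
    the final bound uniform in \<open>a\<close>.\<close>
  also have "\<dots> = (CLINT z|?N. iexp (- (a * z / \<Lambda>)) * \<phi> (z / \<Lambda>) ^ n)"
  proof (intro Bochner_Integration.integral_cong refl)
    fix z
    have "iexp ((?S X - a) / \<Lambda> * z) = iexp (- (a * z / \<Lambda>)) * iexp (z / \<Lambda> * ?S X)" for X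
      unfolding exp_add[symmetric] by (simp add: field_simps diff_divide_distrib)
    then show "(CLINT X|?P. iexp ((?S X - a) / \<Lambda> * z)) = iexp (- (a * z / \<Lambda>)) * \<phi> (z / \<Lambda>) ^ n"
      by (simp only: integral_mult_right_zero char_S)
  qed
  finally have eq: "complex_of_real (P.expectation G)
      = (CLINT z|?N. iexp (- (a * z / \<Lambda>)) * \<phi> (z / \<Lambda>) ^ n)" .
  have "P.expectation G = cmod (complex_of_real (P.expectation G))"
    unfolding norm_of_real G_def by simp
  also have "\<dots> \<le> (\<integral>z. cmod (iexp (- (a * z / \<Lambda>)) * \<phi> (z / \<Lambda>) ^ n) \<partial>?N)"
    unfolding eq by (rule integral_norm_bound)
  \<comment> \<open>For \<open>\<bar>z\<bar> \<ge> \<Lambda>\<close> the trivial bound 1 is used;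
    otherwise the frequency \<open>z / \<Lambda>\<close> is at most 1 in modulus and
    \<open>\<phi>_le\<close> applies to each of the \<open>n\<close> factors.\<close>
  also have "\<dots> \<le> (\<integral>z. indicator {z. \<bar>z\<bar> \<ge> \<Lambda>} z + exp (- (v * z\<^sup>2 / (3 * \<Lambda>\<^sup>2))) \<partial>?N)"
  proof (rule integral_mono)
    show "cmod (iexp (- (a * z / \<Lambda>)) * \<phi> (z / \<Lambda>) ^ n)
        \<le> indicator {z. \<bar>z\<bar> \<ge> \<Lambda>} z + exp (- (v * z\<^sup>2 / (3 * \<Lambda>\<^sup>2)))" for z
    proof (cases "\<bar>z\<bar> \<ge> \<Lambda>")
      case True
      have "cmod (\<phi> (z / \<Lambda>)) ^ n \<le> 1" using \<phi>_le_1 by (intro power_le_one) auto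
      then show ?thesis
        using True by (simp add: norm_mult norm_power add_increasing2)
    next
      case False
      then have "\<bar>z / \<Lambda>\<bar> \<le> 1" using \<open>0 < \<Lambda>\<close> by simp
      then have "cmod (\<phi> (z / \<Lambda>)) ^ n \<le> exp (- ((z / \<Lambda>)\<^sup>2 * \<sigma>2 / 3)) ^ n"
        by (intro power_mono \<phi>_le) auto
      also have "\<dots> = exp (- ((z / \<Lambda>)\<^sup>2 / 3 * (real n * \<sigma>2)))"
        by (simp add: exp_of_nat_mult[symmetric] mult_ac)
      also have "\<dots> \<le> exp (- ((z / \<Lambda>)\<^sup>2 / 3 * v))"
        using v unfolding \<sigma>2_def[symmetric] by (simp add: mult_left_mono)
      finally show ?thesis
        using False by (simp add: norm_mult norm_power power_divide mult_ac)
    qed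
  next
    have "cmod (\<phi> t) ^ n \<le> 1" for t using \<phi>_le_1 by (intro power_le_one) auto
    then show "integrable ?N (\<lambda>z. cmod (iexp (- (a * z / \<Lambda>)) * \<phi> (z / \<Lambda>) ^ n))"
      by (intro N.integrable_const_bound[of _ 1]) (auto simp: norm_mult norm_power)
    show "integrable ?N (\<lambda>z. indicator {z. \<bar>z\<bar> \<ge> \<Lambda>} z + exp (- (v * z\<^sup>2 / (3 * \<Lambda>\<^sup>2))))"
      using int_ind int_exp by (rule Bochner_Integration.integrable_add)
  qed
  also have "\<dots> = measure ?N {z. \<bar>z\<bar> \<ge> \<Lambda>} + (\<integral>z. exp (- (v * z\<^sup>2 / (3 * \<Lambda>\<^sup>2))) \<partial>?N)"
    using int_ind int_exp by (subst Bochner_Integration.integral_add) auto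
  also have "measure ?N {z. \<bar>z\<bar> \<ge> \<Lambda>} \<le> 1 / \<Lambda>\<^sup>2"
    by (rule std_normal_tail_bound[OF \<open>0 < \<Lambda>\<close>])
  finally have G_le: "P.expectation G
      \<le> 1 / \<Lambda>\<^sup>2 + (\<integral>z. exp (- (v * z\<^sup>2 / (3 * \<Lambda>\<^sup>2))) \<partial>?N)" by simp
  \<comment> \<open>On the event the exponent of \<open>G\<close> is at least -1/2, so
    \<open>G\<close> is at least 1/2 there; Markov's inequality then yields the factor 2 of the
    statement.\<close>
  have "P.prob {X \<in> space ?P. \<bar>?S X - a\<bar> \<le> \<Lambda>} \<le> P.prob {X \<in> space ?P. 1 / 2 \<le> G X}"
  proof (intro P.finite_measure_mono subsetI)
    fix X assume "X \<in> {X \<in> space ?P. \<bar>?S X - a\<bar> \<le> \<Lambda>}"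
    then have X: "X \<in> space ?P" and "\<bar>(?S X - a) / \<Lambda>\<bar> \<le> 1" using \<open>0 < \<Lambda>\<close> by auto
    then have "((?S X - a) / \<Lambda>)\<^sup>2 \<le> 1" by (simp only: abs_square_le_1)
    then have "1 / 2 \<le> 1 + - ((?S X - a) / \<Lambda>)\<^sup>2 / 2" by simp
    also have "\<dots> \<le> G X" unfolding G_def by (rule exp_ge_add_one_self)
    finally show "X \<in> {X \<in> space ?P. 1 / 2 \<le> G X}" using X by simp
  qed measurable
  also have "\<dots> \<le> P.expectation G / (1 / 2)"
  proof (rule integral_Markov_inequality_measure[of _ _ "{}"])
    show "integrable ?P G"
      by (intro P.integrable_const_bound[of _ 1] AE_I2 G_meas) (simp add: G_def)
  qed (auto simp: G_def)
  finally show ?thesis using G_le by simp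
qed

section \<open>Hoeffding decomposition of a U-statistic with bounded symmetric kernel\<close>

locale symmetric_kernel = prob_space M for M :: "'a measure" +
  fixes h :: "'a \<Rightarrow> 'a \<Rightarrow> real"
  assumes h_measurable [measurable]: "case_prod h \<in> borel_measurable (M \<Otimes>\<^sub>M M)"
    and h_commute: "h x y = h y x"
    and h_nonneg: "0 \<le> h x y"
    and h_le_1: "h x y \<le> 1"
begin

definition kernel_mean :: real where
  "kernel_mean = (\<integral>x. (\<integral>y. h x y \<partial>M) \<partial>M)"

text \<open>First-order (Hajek) projection of the kernel. Its second moment is the \<zeta> of the
  overview.\<close>

definition hajek :: "'a \<Rightarrow> real" where
  "hajek x = (\<integral>y. h x y \<partial>M) - kernel_mean"

text \<open>Second-order Hoeffding term: what is left of the kernel after its mean and both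
  first-order projections are removed.\<close>

definition degenerate_part :: "'a \<Rightarrow> 'a \<Rightarrow> real" where
  "degenerate_part x y = h x y - kernel_mean - hajek x - hajek y"

definition u_statistic :: "nat \<Rightarrow> (nat \<Rightarrow> 'a) \<Rightarrow> real" where
  "u_statistic n X = 2 / (real n * (real n - 1)) * (\<Sum>(i, j)\<in>index_pairs n. h (X i) (X j))"

lemma integrable_h: "x \<in> space M \<Longrightarrow> integrable M (h x)"
  by (rule integrable_const_bound[of _ 1]) (auto simp: h_nonneg h_le_1)

lemma integral_h_nonneg: "0 \<le> (\<integral>y. h x y \<partial>M)"
  by (simp add: h_nonneg)

lemma integral_h_le_1: "(\<integral>y. h x y \<partial>M) \<le> 1"
proof (cases "integrable M (h x)")
  case True
  then have "(\<integral>y. h x y \<partial>M) \<le> (\<integral>y. 1 \<partial>M)"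
    by (intro integral_mono) (auto simp: h_le_1)
  then show ?thesis by (simp add: prob_space)
next
  \<comment> \<open>This happens only for \<open>x\<close> outside the space of \<open>M\<close>,
    where the section \<open>h x\<close> need not be measurable; the integral then has its default
    value 0.\<close>
  case False
  then show ?thesis by (simp add: not_integrable_integral_eq)
qed

lemma integrable_integral_h: "integrable M (\<lambda>x. \<integral>y. h x y \<partial>M)"
  by (rule integrable_const_bound[of _ 1]) (auto simp: integral_h_nonneg integral_h_le_1)

lemma kernel_mean_nonneg: "0 \<le> kernel_mean"
  unfolding kernel_mean_def by (intro integral_nonneg_AE AE_I2 integral_h_nonneg)

lemma kernel_mean_le_1: "kernel_mean \<le> 1"
proof -
  have "kernel_mean \<le> (\<integral>x. 1 \<partial>M)"
    unfolding kernel_mean_def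
    by (intro integral_mono integrable_integral_h) (auto simp: integral_h_le_1)
  then show ?thesis by (simp add: prob_space)
qed

lemma hajek_measurable [measurable]: "hajek \<in> borel_measurable M"
  unfolding hajek_def by measurable

lemma abs_hajek_le_1: "\<bar>hajek x\<bar> \<le> 1"
  using integral_h_nonneg[of x] integral_h_le_1[of x] kernel_mean_nonneg kernel_mean_le_1
  unfolding hajek_def by linarith

lemma integrable_hajek: "integrable M hajek"
  by (rule integrable_const_bound[of _ 1]) (auto simp: abs_hajek_le_1)

lemma expectation_hajek: "expectation hajek = 0"
  unfolding hajek_def using integrable_integral_h
  by (subst Bochner_Integration.integral_diff) (auto simp: kernel_mean_def[symmetric] prob_space)

lemma degenerate_part_measurable [measurable]:
  "case_prod degenerate_part \<in> borel_measurable (M \<Otimes>\<^sub>M M)"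
  unfolding degenerate_part_def by measurable

lemma abs_degenerate_part_le: "\<bar>degenerate_part x y\<bar> \<le> 3"
  using h_nonneg[of x y] h_le_1[of x y] kernel_mean_nonneg kernel_mean_le_1
    abs_hajek_le_1[of x] abs_hajek_le_1[of y]
  unfolding degenerate_part_def by linarith

lemma degenerate_part_commute: "degenerate_part x y = degenerate_part y x"
  unfolding degenerate_part_def by (simp add: h_commute)

text \<open>The integral of \<open>h x\<close> exceeds \<open>kernel_mean\<close> by exactly
  \<open>hajek x\<close>, and \<open>hajek\<close> itself has mean 0, so everything cancels.\<close>

lemma integral_degenerate_part:
  assumes "x \<in> space M"
  shows "(\<integral>y. degenerate_part x y \<partial>M) = 0"
  unfolding degenerate_part_def
  using integrable_h[OF assms] integrable_hajek
  by (simp add: prob_space expectation_hajek) (simp add: hajek_def)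

text \<open>The factor \<open>n\<close> brings the threshold to order 1. Each
  \<open>hajek (X i)\<close> occurs in \<open>n - 1\<close> pairs, which cancels that factor of the
  normalisation; the degenerate sum keeps the weight \<open>2 / (n - 1)\<close>.\<close>

lemma u_statistic_decomposition:
  assumes "n \<ge> 2"
  shows "real n * (u_statistic n X - m) = real n * (kernel_mean - m) + 2 * (\<Sum>i=1..n. hajek (X i))
    + 2 / (real n - 1) * (\<Sum>(i, j)\<in>index_pairs n. degenerate_part (X i) (X j))"
proof -
  have "(\<Sum>(i, j)\<in>index_pairs n. h (X i) (X j))
      = (\<Sum>(i, j)\<in>index_pairs n.
          kernel_mean + (hajek (X i) + hajek (X j)) + degenerate_part (X i) (X j))"
    by (simp add: degenerate_part_def)
  also have "\<dots> = real n * (real n - 1) / 2 * kernel_mean + (real n - 1) * (\<Sum>i=1..n. hajek (X i))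
      + (\<Sum>(i, j)\<in>index_pairs n. degenerate_part (X i) (X j))"
    using sum_index_pairs_add[of "\<lambda>i. hajek (X i)" n]
    by (simp add: case_prod_unfold sum.distrib card_index_pairs)
  finally have sum_eq: "(\<Sum>(i, j)\<in>index_pairs n. h (X i) (X j)) = \<dots>" .
  have "real n * (u_statistic n X - m)
      = 2 / (real n - 1) * (\<Sum>(i, j)\<in>index_pairs n. h (X i) (X j)) - real n * m"
  proof -
    have "real n * (2 / (real n * (real n - 1)) * s) = 2 / (real n - 1) * s" for s
      using assms by simp
    then show ?thesis
      unfolding u_statistic_def by (subst right_diff_distrib) (simp only:)
  qed
  moreover have "2 / a * (b * a / 2 * k + a * s + r) = b * k + 2 * s + 2 / a * r"
    if "a \<noteq> 0" for a b k r s :: real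
    using that by (simp add: field_simps)
  then have "2 / (real n - 1) * (\<Sum>(i, j)\<in>index_pairs n. h (X i) (X j))
      = real n * kernel_mean + 2 * (\<Sum>i=1..n. hajek (X i))
        + 2 / (real n - 1) * (\<Sum>(i, j)\<in>index_pairs n. degenerate_part (X i) (X j))"
    unfolding sum_eq using assms by simp
  ultimately show ?thesis
    by (simp only: right_diff_distrib)
qed

lemma u_statistic_measurable: "u_statistic n \<in> borel_measurable (Pi\<^sub>M {1..n} (\<lambda>_. M))"
proof -
  have [measurable]: "(\<lambda>X. h (X (fst e)) (X (snd e))) \<in> borel_measurable (Pi\<^sub>M {1..n} (\<lambda>_. M))"
    if "e \<in> index_pairs n" for e
    using h_measurable that by (rule measurable_index_pair)
  show ?thesis unfolding u_statistic_def[abs_def] case_prod_unfold by measurable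
qed

text \<open>Terms of distinct pairs are orthogonal, even when the pairs share an index, so only the
  diagonal remains: one term of size at most 3 * 3 = 9 per pair.\<close>

lemma second_moment_degenerate_sum:
  "(\<integral>X. (\<Sum>(i, j)\<in>index_pairs n. degenerate_part (X i) (X j))\<^sup>2 \<partial>Pi\<^sub>M {1..n} (\<lambda>_. M))
    \<le> 9 * (real n * (real n - 1) / 2)"
proof -
  let ?P = "Pi\<^sub>M {1..n} (\<lambda>_. M)"
  let ?k = "\<lambda>e (X :: nat \<Rightarrow> 'a). degenerate_part (X (fst e)) (X (snd e))"
  interpret P: prob_space ?P by (rule prob_space_iid)
  have meas [measurable]: "?k e \<in> borel_measurable ?P" if "e \<in> index_pairs n" for e
    using degenerate_part_measurable that by (rule measurable_index_pair)
  have prod_le: "\<bar>?k e X * ?k e' X\<bar> \<le> 9" for e e' X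
    using mult_mono[OF abs_degenerate_part_le abs_degenerate_part_le,
        of "X (fst e)" "X (snd e)" "X (fst e')" "X (snd e')"]
    by (simp add: abs_mult mult.commute)
  have int: "integrable ?P (\<lambda>X. ?k e X * ?k e' X)"
    if "e \<in> index_pairs n" "e' \<in> index_pairs n" for e e'
    using prod_le
    by (intro P.integrable_const_bound[of _ 9] AE_I2 borel_measurable_times meas that) simp
  have orth: "P.expectation (\<lambda>X. ?k e X * ?k e' X) = 0"
    if e: "e \<in> index_pairs n" and e': "e' \<in> index_pairs n" and "e \<noteq> e'" for e e'
  proof -
    \<comment> \<open>Both pairs are increasing, so if \<open>e'\<close> contained both entries of
      \<open>e\<close> they would coincide. Hence some entry \<open>i\<close> of \<open>e\<close> is
      missing from \<open>e'\<close>; by symmetry of the kernel it can be put second, with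
      \<open>j\<close> the other entry.\<close>
    obtain i j where ij: "{i, j} \<subseteq> {1..n}" "i \<noteq> j" "i \<notin> {fst e', snd e'}"
      and k_eq: "\<And>X :: nat \<Rightarrow> 'a. ?k e X = degenerate_part (X j) (X i)"
    proof (cases "fst e \<in> {fst e', snd e'}")
      case True
      then have "snd e \<notin> {fst e', snd e'}"
        using e e' \<open>e \<noteq> e'\<close> by (auto simp: index_pairs_def)
      then show ?thesis
        using e by (intro that[of "snd e" "fst e"]) (auto simp: index_pairs_def)
    next
      case False
      then show ?thesis
        using e by (intro that[of "fst e" "snd e"])
          (auto simp: index_pairs_def degenerate_part_commute)
    qed
    show ?thesis
    proof (rule integral_PiM_eq_0I[of _ i])
      fix x assume "x \<in> space (Pi\<^sub>M ({1..n} - {i}) (\<lambda>_. M))"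
      then have "x j \<in> space M" using ij by (auto simp: space_PiM PiE_iff)
      then show "(\<integral>y. ?k e (x(i := y)) * ?k e' (x(i := y)) \<partial>M) = 0"
        using ij unfolding k_eq by (simp add: integral_degenerate_part)
    qed (use ij int[OF e e'] in auto)
  qed
  have "P.expectation (\<lambda>X. (\<Sum>e\<in>index_pairs n. ?k e X)\<^sup>2)
      = (\<Sum>e\<in>index_pairs n. P.expectation (\<lambda>X. (?k e X)\<^sup>2))"
    using P.second_moment_orthogonal_sum[of "index_pairs n" ?k] int orth by simp
  also have "\<dots> \<le> (\<Sum>e\<in>index_pairs n. P.expectation (\<lambda>X. 9))"
  proof (intro sum_mono integral_mono)
    fix e X show "(?k e X)\<^sup>2 \<le> 9" using prod_le[of X e e] by (simp add: power2_eq_square)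
    show "integrable ?P (\<lambda>X. (?k e X)\<^sup>2)" if "e \<in> index_pairs n"
      unfolding power2_eq_square using that by (intro int)
  qed (rule P.integrable_const)
  also have "\<dots> = 9 * (real n * (real n - 1) / 2)"
    unfolding Bochner_Integration.lebesgue_integral_const P.prob_space
    by (simp add: card_index_pairs)
  finally show ?thesis by (simp only: case_prod_unfold)
qed

lemma second_moment_hajek_sum:
  "(\<integral>X. (\<Sum>i=1..n. hajek (X i))\<^sup>2 \<partial>Pi\<^sub>M {1..n} (\<lambda>_. M))
    = real n * expectation (\<lambda>x. (hajek x)\<^sup>2)"
proof -
  let ?P = "Pi\<^sub>M {1..n} (\<lambda>_. M)"
  interpret P: prob_space ?P by (rule prob_space_iid)
  have int: "integrable ?P (\<lambda>X. hajek (X i) * hajek (X j))" if "i \<in> {1..n}" "j \<in> {1..n}" for i j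
    using that
    by (intro P.integrable_const_bound[of _ 1]) (auto simp: abs_mult abs_hajek_le_1 intro!: AE_I2 mult_le_one)
  have orth: "P.expectation (\<lambda>X. hajek (X i) * hajek (X j)) = 0"
    if "i \<in> {1..n}" "j \<in> {1..n}" "i \<noteq> j" for i j
    using that int[OF that(1,2)]
    by (intro integral_PiM_eq_0I[of _ i]) (auto simp: expectation_hajek)
  have "P.expectation (\<lambda>X. (\<Sum>i=1..n. hajek (X i))\<^sup>2)
      = (\<Sum>i=1..n. P.expectation (\<lambda>X. (hajek (X i))\<^sup>2))"
    using P.second_moment_orthogonal_sum[of "{1..n}" "\<lambda>i X. hajek (X i)"] int orth by simp
  also have "\<dots> = (\<Sum>i=1..n. expectation (\<lambda>x. (hajek x)\<^sup>2))"
    by (intro sum.cong refl integral_PiM_component[where f = "\<lambda>x. (hajek x)\<^sup>2"]) auto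
  finally show ?thesis by simp
qed

text \<open>\<open>L\<close> is the allowance for the degenerate part, whose scaled second moment
  \<open>18 * n / (n - 1)\<close> is at most 36. \<open>V\<close> separates small from large
  variance of the linear sum; the bound adds the errors of both cases, so that it involves no
  variance.\<close>

lemma prob_u_statistic_close_le:
  assumes "n \<ge> 2" and "0 < L" and "0 < V" and "C + L \<le> \<Lambda>" and "0 < \<Lambda>"
    and bias: "C + L < real n * \<bar>kernel_mean - m\<bar>"
  shows "measure (Pi\<^sub>M {1..n} (\<lambda>_. M))
      {X \<in> space (Pi\<^sub>M {1..n} (\<lambda>_. M)). real n * \<bar>u_statistic n X - m\<bar> < C}
    \<le> 36 / L\<^sup>2 + 4 * V / (real n * \<bar>kernel_mean - m\<bar> - (C + L))\<^sup>2
      + 2 * (1 / \<Lambda>\<^sup>2 + (\<integral>z. exp (- (V * z\<^sup>2 / (3 * \<Lambda>\<^sup>2))) \<partial>std_normal_distribution))"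
proof -
  let ?P = "Pi\<^sub>M {1..n} (\<lambda>_. M)"
  let ?S = "\<lambda>X. \<Sum>i=1..n. hajek (X i)"
  let ?R = "\<lambda>X. 2 / (real n - 1) * (\<Sum>(i, j)\<in>index_pairs n. degenerate_part (X i) (X j))"
  let ?b = "real n * (kernel_mean - m)"
  let ?I = "1 / \<Lambda>\<^sup>2 + (\<integral>z. exp (- (V * z\<^sup>2 / (3 * \<Lambda>\<^sup>2))) \<partial>std_normal_distribution)"
  interpret P: prob_space ?P by (rule prob_space_iid)
  define D where "D = real n * \<bar>kernel_mean - m\<bar> - (C + L)"
  have "0 < D" using bias by (simp add: D_def)
  have [measurable]: "(\<lambda>X. degenerate_part (X (fst e)) (X (snd e))) \<in> borel_measurable ?P"
    if "e \<in> index_pairs n" for e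
    using degenerate_part_measurable that by (rule measurable_index_pair)
  have R_meas [measurable]: "?R \<in> borel_measurable ?P"
    unfolding case_prod_unfold by measurable
  have S_meas [measurable]: "?S \<in> borel_measurable ?P" by measurable
  have S_le: "\<bar>?S X\<bar> \<le> real n" for X
    using order_trans[OF sum_abs sum_mono, of "{1..n}" "\<lambda>i. hajek (X i)" "\<lambda>_. 1"]
    by (simp add: abs_hajek_le_1)
  have int_S: "integrable ?P (\<lambda>X. (?S X)\<^sup>2)"
    using S_le by (intro P.integrable_const_bound[of _ "(real n)\<^sup>2"]) (auto simp: abs_le_square_iff[symmetric])
  have R: "P.prob {X \<in> space ?P. \<bar>?R X\<bar> \<ge> L} \<le> 36 / L\<^sup>2"
  proof -
    \<comment> \<open>A crude bound, serving only the integrability of the square.\<close>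
    define B where "B = 2 / (real n - 1) * (\<Sum>e\<in>index_pairs n. 3)"
    have "\<bar>?R X\<bar> \<le> B" for X
      unfolding B_def abs_mult using \<open>n \<ge> 2\<close>
      by (intro mult_mono order_trans[OF sum_abs] sum_mono) (auto simp: abs_degenerate_part_le)
    then have "(?R X)\<^sup>2 \<le> B\<^sup>2" for X
      by (intro iffD1[OF abs_le_square_iff] order_trans[OF _ abs_ge_self])
    then have "integrable ?P (\<lambda>X. (?R X)\<^sup>2)"
      by (intro P.integrable_const_bound[of _ "B\<^sup>2"] AE_I2 borel_measurable_power R_meas) simp
    then have "P.prob {X \<in> space ?P. \<bar>?R X\<bar> \<ge> L} \<le> P.expectation (\<lambda>X. (?R X)\<^sup>2) / L\<^sup>2"
      using \<open>0 < L\<close> R_meas by (intro P.second_moment_tail_bound)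
    also have "P.expectation (\<lambda>X. (?R X)\<^sup>2) \<le> (2 / (real n - 1))\<^sup>2 * (9 * (real n * (real n - 1) / 2))"
      using mult_left_mono[OF second_moment_degenerate_sum[of n], of "(2 / (real n - 1))\<^sup>2"]
      by (simp only: power_mult_distrib integral_mult_right_zero zero_le_power2)
    also have "\<dots> = 18 * (real n / (real n - 1))"
    proof -
      have "(2 / a)\<^sup>2 * (9 * (b * a / 2)) = 18 * (b / a)" if "a \<noteq> 0" for a b :: real
        using that by (simp add: power2_eq_square field_simps)
      from this[of "real n - 1" "real n"] show ?thesis using \<open>n \<ge> 2\<close> by linarith
    qed
    also have "\<dots> \<le> 36" using \<open>n \<ge> 2\<close> by (simp add: field_simps)
    finally show ?thesis by (simp add: divide_right_mono)
  qed
  have S: "P.prob {X \<in> space ?P. \<bar>?b + 2 * ?S X\<bar> \<le> C + L} \<le> 4 * V / D\<^sup>2 + 2 * ?I"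
  proof (cases "real n * expectation (\<lambda>x. (hajek x)\<^sup>2) \<le> V")
    case True
    \<comment> \<open>Small variance: to offset the bias down to \<open>C + L\<close>, twice the
      linear sum must reach \<open>D\<close> in modulus.\<close>
    have "P.prob {X \<in> space ?P. \<bar>?b + 2 * ?S X\<bar> \<le> C + L}
        \<le> P.prob {X \<in> space ?P. \<bar>?S X\<bar> \<ge> D / 2}"
      by (intro P.finite_measure_mono) (auto simp: D_def abs_mult)
    also have "\<dots> \<le> P.expectation (\<lambda>X. (?S X)\<^sup>2) / (D / 2)\<^sup>2"
      using int_S S_meas \<open>0 < D\<close> by (intro P.second_moment_tail_bound) simp_all
    also have "\<dots> \<le> V / (D / 2)\<^sup>2"
      unfolding second_moment_hajek_sum using True by (intro divide_right_mono) auto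
    also have "\<dots> = 4 * V / D\<^sup>2" by (simp add: power2_eq_square)
    also have "\<dots> \<le> 4 * V / D\<^sup>2 + 2 * ?I" by simp
    finally show ?thesis .
  next
    case False
    \<comment> \<open>Large variance: the event confines the linear sum to a window of half-width at
      most \<Lambda> around \<open>- ?b / 2\<close>.\<close>
    have "P.prob {X \<in> space ?P. \<bar>?b + 2 * ?S X\<bar> \<le> C + L}
        \<le> P.prob {X \<in> space ?P. \<bar>?S X - - ?b / 2\<bar> \<le> \<Lambda>}"
      using \<open>C + L \<le> \<Lambda>\<close> by (intro P.finite_measure_mono) (auto)
    also have "\<dots> \<le> 2 * ?I"
      using False \<open>0 < V\<close> \<open>0 < \<Lambda>\<close>
      by (intro iid_sum_anti_concentration abs_hajek_le_1 expectation_hajek) auto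
    also have "\<dots> \<le> 4 * V / D\<^sup>2 + 2 * ?I" using \<open>0 < V\<close> by simp
    finally show ?thesis .
  qed
  have "P.prob {X \<in> space ?P. real n * \<bar>u_statistic n X - m\<bar> < C}
      \<le> P.prob ({X \<in> space ?P. \<bar>?R X\<bar> \<ge> L} \<union> {X \<in> space ?P. \<bar>?b + 2 * ?S X\<bar> \<le> C + L})"
  proof (intro P.finite_measure_mono subsetI)
    fix X assume X: "X \<in> {X \<in> space ?P. real n * \<bar>u_statistic n X - m\<bar> < C}"
    have "\<bar>?b + 2 * ?S X + ?R X\<bar> = real n * \<bar>u_statistic n X - m\<bar>"
      unfolding u_statistic_decomposition[OF \<open>n \<ge> 2\<close>, symmetric] by (simp add: abs_mult)
    then have "\<bar>?b + 2 * ?S X + ?R X\<bar> < C" using X by simp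
    then have "\<bar>?R X\<bar> \<ge> L \<or> \<bar>?b + 2 * ?S X\<bar> \<le> C + L" by linarith
    then show "X \<in> {X \<in> space ?P. \<bar>?R X\<bar> \<ge> L} \<union> {X \<in> space ?P. \<bar>?b + 2 * ?S X\<bar> \<le> C + L}"
      using X by blast
  qed measurable
  also have "\<dots> \<le> P.prob {X \<in> space ?P. \<bar>?R X\<bar> \<ge> L}
      + P.prob {X \<in> space ?P. \<bar>?b + 2 * ?S X\<bar> \<le> C + L}"
    by (rule measure_Un_le) measurable
  finally show ?thesis using R S unfolding D_def by linarith
qed

end

section \<open>The law of the inner product on the sphere\<close>

lemma dot_commute: "dot p x y = dot p y x"
  by (simp add: dot_def mult.commute)

lemma dot_measurable_sphere:
  assumes "prob_on_sphere p \<mu>"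
  shows "case_prod (dot p) \<in> borel_measurable (\<mu> \<Otimes>\<^sub>M \<mu>)"
proof -
  have [measurable]: "(\<lambda>x. x i) \<in> borel_measurable \<mu>" if "i < p" for i
  proof -
    have "(\<lambda>x. x i) \<in> borel_measurable (sphere_space p)"
      unfolding sphere_space_def using that
      by (intro measurable_restrict_space1 measurable_component_singleton) simp
    then show ?thesis
      using assms by (simp add: prob_on_sphere_def cong: measurable_cong_sets)
  qed
  show ?thesis unfolding dot_def by measurable
qed

lemma real_distribution_dot:
  assumes "prob_on_sphere p \<mu>"
  shows "real_distribution (distr (\<mu> \<Otimes>\<^sub>M \<mu>) borel (case_prod (dot p)))"
proof -
  interpret prob_space \<mu> using assms by (simp add: prob_on_sphere_def)
  interpret pair_prob_space \<mu> \<mu> ..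
  show ?thesis
    using dot_measurable_sphere[OF assms] by (rule P.real_distribution_distr)
qed

text \<open>Bounds and right-continuity of \<open>inner_cdf\<close> are inherited from distribution
  functions through this identification.\<close>

lemma inner_cdf_eq_cdf:
  assumes "prob_on_sphere p \<mu>"
  shows "inner_cdf p \<mu> t = cdf (distr (\<mu> \<Otimes>\<^sub>M \<mu>) borel (case_prod (dot p))) t"
  unfolding inner_cdf_def cdf_def
  by (subst measure_distr[OF dot_measurable_sphere[OF assms]])
    (auto intro!: arg_cong[where f = "measure _"])

lemma inner_cdf_nonneg: "0 \<le> inner_cdf p \<mu> t"
  by (simp add: inner_cdf_def)

lemma inner_cdf_le_1: "prob_on_sphere p \<mu> \<Longrightarrow> inner_cdf p \<mu> t \<le> 1"
  using real_distribution.cdf_bounded_prob[OF real_distribution_dot] by (simp add: inner_cdf_eq_cdf)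

lemma inner_cdf_right_continuous:
  assumes "prob_on_sphere p \<mu>"
  shows "continuous (at_right t) (inner_cdf p \<mu>)"
proof -
  interpret real_distribution "distr (\<mu> \<Otimes>\<^sub>M \<mu>) borel (case_prod (dot p))"
    by (rule real_distribution_dot[OF assms])
  show ?thesis
    using cdf_is_right_cont[of t] by (simp add: inner_cdf_eq_cdf[OF assms, abs_def])
qed

text \<open>For this kernel the U-statistic is the empirical distribution function of the pairwise
  inner products at level \<open>t\<close>.\<close>

lemma symmetric_kernel_dot_le:
  assumes "prob_on_sphere p \<mu>"
  shows "symmetric_kernel \<mu> (\<lambda>x y. if dot p x y \<le> t then 1 else 0)"
proof -
  interpret prob_space \<mu> using assms by (simp add: prob_on_sphere_def)
  note [measurable] = dot_measurable_sphere[OF assms]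
  show ?thesis
    by unfold_locales (auto simp: dot_commute)
qed

lemma kernel_mean_dot_le:
  assumes "prob_on_sphere p \<mu>"
  shows "symmetric_kernel.kernel_mean \<mu> (\<lambda>x y. if dot p x y \<le> t then 1 else 0) = inner_cdf p \<mu> t"
proof -
  interpret symmetric_kernel \<mu> "\<lambda>x y. if dot p x y \<le> t then 1 else 0"
    by (rule symmetric_kernel_dot_le[OF assms])
  interpret PP: pair_prob_space \<mu> \<mu> ..
  let ?A = "{(x, y) \<in> space (\<mu> \<Otimes>\<^sub>M \<mu>). dot p x y \<le> t}"
  have "?A = {z \<in> space (\<mu> \<Otimes>\<^sub>M \<mu>). case_prod (dot p) z \<le> t}" by auto
  also have "\<dots> \<in> sets (\<mu> \<Otimes>\<^sub>M \<mu>)"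
    using dot_measurable_sphere[OF assms] by measurable
  finally have "inner_cdf p \<mu> t = (\<integral>z. indicator ?A z \<partial>(\<mu> \<Otimes>\<^sub>M \<mu>))"
    by (simp add: inner_cdf_def)
  also have "\<dots> = (\<integral>z. (case z of (x, y) \<Rightarrow> if dot p x y \<le> t then 1 else 0) \<partial>(\<mu> \<Otimes>\<^sub>M \<mu>))"
    by (intro Bochner_Integration.integral_cong refl) (auto simp: indicator_def split: if_splits)
  also have "\<dots> = kernel_mean"
    unfolding kernel_mean_def
    by (rule PP.integral_fst[symmetric], rule PP.P.integrable_const_bound[of _ 1])
      (use h_measurable in auto)
  finally show ?thesis ..
qed

section \<open>Measurability of the test statistic\<close>

lemma SUP_right_continuous_eq_SUP_rational:
  fixes f :: "real \<Rightarrow> real"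
  assumes "\<And>t. t \<in> {a..<b} \<Longrightarrow> continuous (at_right t) f" and "bdd_above (f ` {a..b})"
    and "a < b" and "b \<in> \<rat>"
  shows "(SUP t\<in>{a..b}. f t) = (SUP t\<in>{a..b} \<inter> \<rat>. f t)"
proof (rule antisym)
  let ?s = "SUP t\<in>{a..b} \<inter> \<rat>. f t"
  have bdd: "bdd_above (f ` ({a..b} \<inter> \<rat>))"
    using assms(2) by (rule bdd_above_mono) auto
  have "f t \<le> ?s" if t: "t \<in> {a..b}" for t
  proof (cases "t = b")
    \<comment> \<open>The endpoint \<open>b\<close> cannot be approached from the right within the
      interval; it is itself one of the rational points.\<close>
    case True
    then show ?thesis using bdd assms(3,4) by (intro cSUP_upper) auto
  next
    case False
    show ?thesis
    proof (rule ccontr)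
      \<comment> \<open>By right-continuity a strict excess at \<open>t\<close> persists just to the
        right of \<open>t\<close>, where there is a rational point; taking it below
        \<open>min e b\<close> keeps it in the interval.\<close>
      assume "\<not> f t \<le> ?s"
      then have "?s < f t" by simp
      moreover have "(f \<longlongrightarrow> f t) (at_right t)"
        using assms(1)[of t] False t by (auto simp: continuous_within)
      ultimately have "\<forall>\<^sub>F u in at_right t. ?s < f u"
        by (rule order_tendstoD(1)[rotated])
      then obtain e where "t < e" and e: "\<And>u. t < u \<Longrightarrow> u < e \<Longrightarrow> ?s < f u"
        unfolding eventually_at_right_field by auto
      moreover obtain u where "u \<in> \<rat>" "t < u" "u < min e b"
        using Rats_dense_in_real[of t "min e b"] False t \<open>t < e\<close> by auto
      moreover from calculation have "f u \<le> ?s"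
        using bdd t by (intro cSUP_upper) auto
      ultimately show False by fastforce
    qed
  qed
  then show "(SUP t\<in>{a..b}. f t) \<le> ?s"
    using assms(3) by (intro cSUP_least) auto
  have "b \<in> {a..b} \<inter> \<rat>" using assms(3,4) by simp
  then show "?s \<le> (SUP t\<in>{a..b}. f t)"
    using assms(2) by (intro cSUP_subset_mono) blast+
qed

text \<open>The step takes its upper value at the jump \<open>d\<close>, so it is constant
  immediately to the right of every point.\<close>

lemma continuous_at_right_step:
  fixes d :: real
  shows "continuous (at_right t) (\<lambda>t. if d \<le> t then 1 else 0 :: real)"
proof -
  have "\<forall>\<^sub>F u in at_right t. (if d \<le> t then 1 else 0 :: real) = (if d \<le> u then 1 else 0)"
  proof (cases "d \<le> t")
    case True
    then show ?thesis by (auto simp: eventually_at_right_field intro!: exI[of _ "t + 1"])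
  next
    case False
    then show ?thesis by (auto simp: eventually_at_right_field intro!: exI[of _ d])
  qed
  then show ?thesis
    unfolding continuous_within
    by (rule Lim_transform_eventually[OF tendsto_const])
qed

definition deviation :: "nat \<Rightarrow> nat \<Rightarrow> (nat \<Rightarrow> nat \<Rightarrow> real) \<Rightarrow> real \<Rightarrow> real" where
  "deviation p n X t =
     \<bar>2 / (real n * (real n - 1)) *
        (\<Sum>(i, j)\<in>index_pairs n. if dot p (X i) (X j) \<le> t then 1 else 0)
      - inner_cdf p (unif_sphere p) t\<bar>"

lemma test_statistic_eq: "test_statistic p n X = (SUP t\<in>{-1..1}. deviation p n X t)"
  by (simp add: test_statistic_def deviation_def index_pairs_def)

text \<open>Any bound independent of \<open>t\<close> makes the supremum meaningful. Keeping the
  cardinality covers \<open>n \<le> 1\<close> as well, where the quotient is a division by 0 with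
  value 0.\<close>

lemma deviation_le:
  assumes "p \<ge> 1"
  shows "deviation p n X t \<le> \<bar>2 / (real n * (real n - 1))\<bar> * card (index_pairs n) + 1"
proof -
  have "\<bar>\<Sum>(i, j)\<in>index_pairs n. if dot p (X i) (X j) \<le> t then 1 else 0 :: real\<bar>
      \<le> (\<Sum>(i, j)\<in>index_pairs n. 1)"
    by (intro order_trans[OF sum_abs] sum_mono) auto
  then have "\<bar>2 / (real n * (real n - 1)) *
        (\<Sum>(i, j)\<in>index_pairs n. if dot p (X i) (X j) \<le> t then 1 else 0)\<bar>
      \<le> \<bar>2 / (real n * (real n - 1))\<bar> * card (index_pairs n)"
    unfolding abs_mult by (intro mult_left_mono) (auto simp: case_prod_unfold)
  then show ?thesis
    using inner_cdf_nonneg[of p "unif_sphere p" t]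
      inner_cdf_le_1[OF prob_on_sphere_unif_sphere[OF assms], of t]
    unfolding deviation_def by linarith
qed

lemma bdd_above_deviation: "p \<ge> 1 \<Longrightarrow> bdd_above (deviation p n X ` A)"
  by (auto intro!: bdd_aboveI2 deviation_le)

text \<open>Right-continuity in \<open>t\<close> reduces the uncountable supremum to rational
  levels. This makes rejection a measurable event, so that its probability can be bounded through
  the complement.\<close>

lemma test_statistic_measurable:
  assumes "p \<ge> 1" and "prob_on_sphere p \<mu>"
  shows "test_statistic p n \<in> borel_measurable (Pi\<^sub>M {1..n} (\<lambda>_. \<mu>))"
proof -
  have "continuous (at_right t) (deviation p n X)" for X t
    unfolding deviation_def[abs_def] case_prod_unfold
    using inner_cdf_right_continuous[OF prob_on_sphere_unif_sphere[OF assms(1)], of t]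
    by (intro continuous_intros continuous_at_right_step) auto
  then have eq: "test_statistic p n = (\<lambda>X. SUP t\<in>{-1..1} \<inter> \<rat>. deviation p n X t)"
    unfolding test_statistic_eq[abs_def]
    by (intro ext SUP_right_continuous_eq_SUP_rational bdd_above_deviation assms) auto
  have [measurable]: "(\<lambda>X. dot p (X (fst e)) (X (snd e))) \<in> borel_measurable (Pi\<^sub>M {1..n} (\<lambda>_. \<mu>))"
    if "e \<in> index_pairs n" for e
    using dot_measurable_sphere[OF assms(2)] that by (rule measurable_index_pair)
  have "(\<lambda>X. deviation p n X t) \<in> borel_measurable (Pi\<^sub>M {1..n} (\<lambda>_. \<mu>))" for t
    unfolding deviation_def case_prod_unfold by measurable
  then show ?thesis
    unfolding eq
    by (intro borel_measurable_cSUP bdd_above_deviation assms) (auto intro: countable_Int2 countable_rat)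
qed

section \<open>Bounding the probability of acceptance\<close>

lemma threshold_le:
  assumes "n \<ge> 2"
  shows "real n * threshold n c \<le> 2 * \<bar>c\<bar>"
proof -
  \<comment> \<open>For \<open>n \<ge> 2\<close> we have \<open>n \<le> 2 * (n - 1)\<close>, so
    \<open>n / sqrt (n * (n - 1))\<close> is at most \<open>sqrt 2\<close>; the other
    \<open>sqrt 2\<close> comes from the threshold.\<close>
  have "sqrt 2 * real n \<le> 2 * sqrt (real n * (real n - 1))"
  proof -
    have "2 * (real n)\<^sup>2 \<le> 4 * (real n * (real n - 1))"
      using assms by (simp add: power2_eq_square algebra_simps)
    then have "sqrt (2 * (real n)\<^sup>2) \<le> sqrt (4 * (real n * (real n - 1)))"
      by (rule real_sqrt_le_mono)
    then show ?thesis by (simp only: real_sqrt_mult real_sqrt_four) (simp)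
  qed
  then have "sqrt 2 * real n / sqrt (real n * (real n - 1)) \<le> 2"
    using assms by (simp add: pos_divide_le_eq)
  then have "(sqrt 2 * real n / sqrt (real n * (real n - 1))) * \<bar>c\<bar> \<le> 2 * \<bar>c\<bar>"
    by (rule mult_right_mono) simp
  moreover have "real n * threshold n c \<le> (sqrt 2 * real n / sqrt (real n * (real n - 1))) * \<bar>c\<bar>"
    unfolding threshold_def using assms
    by (simp add: divide_right_mono mult_left_mono mult_ac)
  ultimately show ?thesis by linarith
qed

text \<open>The supremum need not be attained, but a positive supremum exceeds its own half, and so
  does one of its members. The lost factor 2 does not affect divergence.\<close>

lemma sphere_dist_attained_up_to_half:
  assumes "prob_on_sphere p \<mu>" and "prob_on_sphere p \<nu>" and "0 < sphere_dist p \<mu> \<nu>"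
  obtains t where "t \<in> {-1..1}" and "sphere_dist p \<mu> \<nu> / 2 < \<bar>inner_cdf p \<mu> t - inner_cdf p \<nu> t\<bar>"
proof -
  have "bdd_above ((\<lambda>t. \<bar>inner_cdf p \<mu> t - inner_cdf p \<nu> t\<bar>) ` {-1..1})"
  proof (rule bdd_aboveI2)
    fix t show "\<bar>inner_cdf p \<mu> t - inner_cdf p \<nu> t\<bar> \<le> 1"
      using inner_cdf_nonneg[of p \<mu> t] inner_cdf_le_1[OF assms(1), of t]
        inner_cdf_nonneg[of p \<nu> t] inner_cdf_le_1[OF assms(2), of t] by linarith
  qed
  moreover have "sphere_dist p \<mu> \<nu> / 2 < sphere_dist p \<mu> \<nu>" using assms(3) by simp
  ultimately show ?thesis
    using that unfolding sphere_dist_def by (subst (asm) less_cSUP_iff) auto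
qed

text \<open>Acceptance keeps the deviation below the threshold at every level, in particular at the
  given \<open>t\<close>. This reduces the claim to a single U-statistic, with
  \<open>C = 2 * \<bar>c\<bar>\<close> bounding \<open>n\<close> times the threshold.\<close>

lemma prob_not_reject_le:
  assumes "p \<ge> 1" and \<mu>: "prob_on_sphere p \<mu>" and "n \<ge> 2" and t: "t \<in> {-1..1}"
    and "0 < L" and "0 < V" and "2 * \<bar>c\<bar> + L \<le> \<Lambda>"
    and bias: "2 * \<bar>c\<bar> + L < real n * \<bar>inner_cdf p \<mu> t - inner_cdf p (unif_sphere p) t\<bar>"
  shows "1 - measure (Pi\<^sub>M {1..n} (\<lambda>_. \<mu>)) {X \<in> space (Pi\<^sub>M {1..n} (\<lambda>_. \<mu>)). unif_test p n c X = 1}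
    \<le> 36 / L\<^sup>2
      + 4 * V / (real n * \<bar>inner_cdf p \<mu> t - inner_cdf p (unif_sphere p) t\<bar> - (2 * \<bar>c\<bar> + L))\<^sup>2
      + 2 * (1 / \<Lambda>\<^sup>2 + (\<integral>z. exp (- (V * z\<^sup>2 / (3 * \<Lambda>\<^sup>2))) \<partial>std_normal_distribution))"
proof -
  let ?P = "Pi\<^sub>M {1..n} (\<lambda>_. \<mu>)" and ?m = "inner_cdf p (unif_sphere p) t"
  interpret symmetric_kernel \<mu> "\<lambda>x y. if dot p x y \<le> t then 1 else 0"
    by (rule symmetric_kernel_dot_le[OF \<mu>])
  interpret P: prob_space ?P by (rule prob_space_iid)
  note [measurable] = test_statistic_measurable[OF \<open>p \<ge> 1\<close> \<mu>]
  have "{X \<in> space ?P. unif_test p n c X = 1} = {X \<in> space ?P. threshold n c \<le> test_statistic p n X}"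
    by (auto simp: unif_test_def split: if_splits)
  also have "\<dots> \<in> sets ?P" by measurable
  finally have "1 - P.prob {X \<in> space ?P. unif_test p n c X = 1}
      = P.prob (space ?P - {X \<in> space ?P. unif_test p n c X = 1})"
    by (rule P.prob_compl[symmetric])
  also have "\<dots> \<le> P.prob {X \<in> space ?P. real n * \<bar>u_statistic n X - ?m\<bar> < 2 * \<bar>c\<bar>}"
  proof (intro P.finite_measure_mono subsetI)
    fix X assume X: "X \<in> space ?P - {X \<in> space ?P. unif_test p n c X = 1}"
    have "\<bar>u_statistic n X - ?m\<bar> = deviation p n X t"
      by (simp add: u_statistic_def deviation_def)
    also have "\<dots> \<le> test_statistic p n X"
      unfolding test_statistic_eq using t \<open>p \<ge> 1\<close> by (intro cSUP_upper bdd_above_deviation)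
    also have "\<dots> < threshold n c"
      using X by (auto simp: unif_test_def split: if_splits)
    finally have "real n * \<bar>u_statistic n X - ?m\<bar> < real n * threshold n c"
      using \<open>n \<ge> 2\<close> by simp
    then show "X \<in> {X \<in> space ?P. real n * \<bar>u_statistic n X - ?m\<bar> < 2 * \<bar>c\<bar>}"
      using X threshold_le[OF \<open>n \<ge> 2\<close>, of c] by simp
  next
    have [measurable]: "u_statistic n \<in> borel_measurable ?P" by (rule u_statistic_measurable)
    show "{X \<in> space ?P. real n * \<bar>u_statistic n X - ?m\<bar> < 2 * \<bar>c\<bar>} \<in> sets ?P" by measurable
  qed
  also have "\<dots> \<le> 36 / L\<^sup>2 + 4 * V / (real n * \<bar>kernel_mean - ?m\<bar> - (2 * \<bar>c\<bar> + L))\<^sup>2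
      + 2 * (1 / \<Lambda>\<^sup>2 + (\<integral>z. exp (- (V * z\<^sup>2 / (3 * \<Lambda>\<^sup>2))) \<partial>std_normal_distribution))"
    using assms by (intro prob_u_statistic_close_le) (auto simp: kernel_mean_dot_le[OF \<mu>])
  finally show ?thesis unfolding kernel_mean_dot_le[OF \<mu>] .
qed

section \<open>Choice of constants and passage to the limit\<close>

theorem theorem2:
  fixes \<alpha> c :: real
    and p :: "nat \<Rightarrow> nat"
    and \<mu> :: "nat \<Rightarrow> (nat \<Rightarrow> real) measure"
    and W :: "'w measure"
    and B :: "real \<Rightarrow> 'w \<Rightarrow> real"
  assumes "0 < \<alpha>" and "\<alpha> < 1"
    and "\<And>n. n \<ge> 1 \<Longrightarrow> p n \<ge> 2"
    and "\<And>n. n \<ge> 1 \<Longrightarrow> prob_on_sphere (p n) (\<mu> n)"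
    and "brownian_bridge W B"
    and "measure W {\<omega> \<in> space W. (SUP t\<in>{0..1}. \<bar>B t \<omega>\<bar>) \<le> c} = 1 - \<alpha>"
    and "filterlim (\<lambda>n. real n * sphere_dist (p n) (\<mu> n) (unif_sphere (p n))) at_top sequentially"
  shows "(\<lambda>n. measure (Pi\<^sub>M {1..n} (\<lambda>_. \<mu> n))
            {X \<in> space (Pi\<^sub>M {1..n} (\<lambda>_. \<mu> n)). unif_test (p n) n c X = 1}) \<longlonglongrightarrow> 1"
proof (rule tendstoI)
  fix \<epsilon> :: real assume "0 < \<epsilon>"
  let ?\<beta> = "\<lambda>n. measure (Pi\<^sub>M {1..n} (\<lambda>_. \<mu> n))
    {X \<in> space (Pi\<^sub>M {1..n} (\<lambda>_. \<mu> n)). unif_test (p n) n c X = 1}"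
  let ?I = "\<lambda>\<Lambda> V. \<integral>z. exp (- (V * z\<^sup>2 / (3 * \<Lambda>\<^sup>2))) \<partial>std_normal_distribution"
  \<comment> \<open>The constants are chosen in the order \<open>L\<close>, \<Lambda>,
    \<open>m\<close>, \<open>D\<close>, each depending on the earlier ones but not on
    \<open>n\<close>. The error budget is \<open>\<epsilon> / 4 + \<epsilon> / 4 + 2 * (\<epsilon> /
    8 + \<epsilon> / 8)\<close>.\<close>
  have "((\<lambda>L::real. 36 / L\<^sup>2) \<longlongrightarrow> 0) at_top" by real_asymp
  then have "\<forall>\<^sub>F L::real in at_top. 36 / L\<^sup>2 < \<epsilon> / 4"
    using \<open>0 < \<epsilon>\<close> by (intro order_tendstoD) auto
  from eventually_happens'[OF _ eventually_conj[OF this eventually_gt_at_top[of 0]]]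
  obtain L :: real where L: "0 < L" "36 / L\<^sup>2 < \<epsilon> / 4" by auto
  define A where "A = 2 * \<bar>c\<bar> + L"
  have "((\<lambda>\<Lambda>::real. 1 / \<Lambda>\<^sup>2) \<longlongrightarrow> 0) at_top" by real_asymp
  then have "\<forall>\<^sub>F \<Lambda>::real in at_top. 1 / \<Lambda>\<^sup>2 < \<epsilon> / 8"
    using \<open>0 < \<epsilon>\<close> by (intro order_tendstoD) auto
  from eventually_happens'[OF _ eventually_conj[OF this eventually_ge_at_top[of A]]]
  obtain \<Lambda> :: real where \<Lambda>: "A \<le> \<Lambda>" "1 / \<Lambda>\<^sup>2 < \<epsilon> / 8" by auto
  have "0 < \<Lambda>" using L \<Lambda> by (simp add: A_def)
  \<comment> \<open>With the window \<Lambda> fixed, the variance cutoff \<open>V = m\<close> is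
    taken large enough for the linear sum to spread beyond it.\<close>
  have "(\<lambda>m::nat. \<integral>z. exp (- (1 / (3 * \<Lambda>\<^sup>2) * real m * z\<^sup>2)) \<partial>std_normal_distribution) \<longlonglongrightarrow> 0"
    using \<open>0 < \<Lambda>\<close> by (intro std_normal_laplace_tendsto_0) simp
  then have "(\<lambda>m::nat. ?I \<Lambda> (real m)) \<longlonglongrightarrow> 0" by simp
  then have "\<forall>\<^sub>F m in sequentially. ?I \<Lambda> (real m) < \<epsilon> / 8"
    using \<open>0 < \<epsilon>\<close> by (intro order_tendstoD) auto
  from eventually_happens'[OF _ eventually_conj[OF this eventually_gt_at_top[of 0]]]
  obtain m :: nat where m: "0 < m" "?I \<Lambda> (real m) < \<epsilon> / 8" by auto
  have "((\<lambda>D. 4 * real m / (D - A)\<^sup>2) \<longlongrightarrow> 0) at_top" by real_asymp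
  then have "\<forall>\<^sub>F D in at_top. 4 * real m / (D - A)\<^sup>2 < \<epsilon> / 4"
    using \<open>0 < \<epsilon>\<close> by (intro order_tendstoD) auto
  then obtain D\<^sub>0 where D\<^sub>0: "\<And>D. D \<ge> D\<^sub>0 \<Longrightarrow> 4 * real m / (D - A)\<^sup>2 < \<epsilon> / 4"
    by (auto simp: eventually_at_top_linorder)
  \<comment> \<open>A scaled bias beyond \<open>D\<^sub>0\<close> makes the Chebyshev term small;
    beyond \<open>A\<close> it meets the bias condition of
    \<open>prob_not_reject_le\<close>.\<close>
  define D where "D = max D\<^sub>0 A"
  have "0 < A" using L by (simp add: A_def)
  \<comment> \<open>The factor 2 compensates for the level \<open>t\<close> capturing only half of
    the distance.\<close>
  have "\<forall>\<^sub>F n in sequentially. 2 * D < real n * sphere_dist (p n) (\<mu> n) (unif_sphere (p n))"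
    using assms(7) by (simp add: filterlim_at_top_dense)
  then show "\<forall>\<^sub>F n in sequentially. dist (?\<beta> n) 1 < \<epsilon>"
    using eventually_ge_at_top[of 2]
  proof eventually_elim
    case (elim n)
    let ?d = "sphere_dist (p n) (\<mu> n) (unif_sphere (p n))"
    have p: "p n \<ge> 1" and \<mu>: "prob_on_sphere (p n) (\<mu> n)"
      using assms(3,4)[of n] elim(2) by auto
    have "0 < real n * ?d" using elim(1) \<open>0 < A\<close> by (simp add: D_def max_def split: if_splits)
    then have "0 < ?d" by (simp add: zero_less_mult_iff)
    then obtain t where t: "t \<in> {-1..1}"
      and d: "?d / 2 < \<bar>inner_cdf (p n) (\<mu> n) t - inner_cdf (p n) (unif_sphere (p n)) t\<bar>"
      using sphere_dist_attained_up_to_half[OF \<mu> prob_on_sphere_unif_sphere[OF p]] by metis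
    define \<Delta> where "\<Delta> = real n * \<bar>inner_cdf (p n) (\<mu> n) t - inner_cdf (p n) (unif_sphere (p n)) t\<bar>"
    have "real n * (?d / 2) < \<Delta>"
      unfolding \<Delta>_def using elim(2) by (intro mult_strict_left_mono d) simp
    then have "D < \<Delta>" using elim(1) by simp
    then have "A < \<Delta>" "D\<^sub>0 \<le> \<Delta>" by (auto simp: D_def)
    have "1 - ?\<beta> n \<le> 36 / L\<^sup>2 + 4 * real m / (\<Delta> - A)\<^sup>2 + 2 * (1 / \<Lambda>\<^sup>2 + ?I \<Lambda> (real m))"
      unfolding \<Delta>_def A_def
      using L(1) m(1) \<Lambda>(1) \<open>A < \<Delta>\<close>
      by (intro prob_not_reject_le p \<mu> elim(2) t) (auto simp: A_def \<Delta>_def)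
    also have "\<dots> < \<epsilon>"
    proof -
      have "w + x + 2 * (y + z) < \<epsilon>" if "w < \<epsilon> / 4" "x < \<epsilon> / 4" "y < \<epsilon> / 8" "z < \<epsilon> / 8" for w x y z
        using that by (simp add: field_simps)
      then show ?thesis using L(2) D\<^sub>0[OF \<open>D\<^sub>0 \<le> \<Delta>\<close>] \<Lambda>(2) m(2) by blast
    qed
    finally have "1 - ?\<beta> n < \<epsilon>" .
    moreover have "?\<beta> n \<le> 1"
    proof -
      interpret prob_space "\<mu> n" using \<mu> by (simp add: prob_on_sphere_def)
      interpret P: prob_space "Pi\<^sub>M {1..n} (\<lambda>_. \<mu> n)" by (rule prob_space_iid)
      show ?thesis by (rule P.prob_le_1)
    qed
    ultimately show ?case by (simp add: dist_real_def)
  qed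
qed

end
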